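(* Let $I$ be a solvable search instance (with nonnegative edge costs) whose heuristic $h$ is consistent, zero at goals, and strictly positive at every non-goal. For $0\le\alpha<1$ write $E_\alpha$ for the set of non-goal states expanded by weighted A* with evaluation function $f_\alpha=g+\alpha h$ (this set is the same for all tie-breakers and random outcomes). Then for every tie-breaker $\tau$ of ordinary A* ($\alpha=1$), every random outcome $\rho$, and every $0\le\alpha<1$, $$E_{1,\tau}(I;\rho)\subseteq S_{\le}\subseteq E_\alpha\subseteq E_0=\{v\notin\mathcal G: g^*(v)<C^*\}.$$ Moreover, $$0\le\alpha<\beta<1\quad\Longrightarrow\quad E_\beta\subseteq E_\alpha.$$
   Context: **Search instances.** A search instance is $I=(V,A,c,s,\mathcal G,h)$ with $(V,A)$ a finite directed graph, $c:A\to\mathbb R_{\ge0}$ edge costs, $s\notin\mathcal G$ the initial state, $\mathcal G\subseteq V$ the goals, $h:V\to\mathbb R$ a heuristic, together with a fixed order in which successors of each state are generated. $g^*(v)$ is the least cost of a path from $s$ to $v$ ($+\infty$ if none), $h^*(v)$ the least cost of a path from $v$ to a goal ($+\infty$ if none). The instance is solvable if $C^*:=h^*(s)<\infty$. $h$ is consistent if $h(u)\le c(u,v)+h(v)$ for all $(u,v)\in A$. $S_{\le}$ is the set of reachable non-goal states $v$ with $g^*(v)+h(v)\le C^*$. **Weighted A\* model.** Fix $0\le\alpha\le1$ and $f_\alpha=g+\alpha h$ ($\alpha=1$ is ordinary A*, $\alpha=0$ is uniform-cost search). Initially OPEN contains only $s$ with $g(s)=0$, and CLOSED is empty. Each OPEN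 entry stores its best known $g$-value, parent, first-insertion timestamp and goal status. At a selection point let $\mathrm{OPEN}_{\min}$ be the set of $v\in\mathrm{OPEN}$ minimizing $f_\alpha(v)=g(v)+\alpha h(v)$. If $\mathrm{OPEN}_{\min}$ contains a goal, a goal is selected and the search terminates (goal preference; selecting a goal is not an expansion). Otherwise the tie-breaker selects a non-goal in $\mathrm{OPEN}_{\min}$, which is expanded: it is moved from OPEN to CLOSED and all its successors are generated in the given order. A newly encountered state is inserted into OPEN; a strictly smaller tentative $g$ updates an existing OPEN entry's $g$ and parent but keeps its first-insertion timestamp; equal- and higher-cost duplicates are discarded. (With consistent $h$ an expanded state has $g=g^*$ and is never reopened.) **Tie-breakers.** A tie-breaker is an arbitrary, possibly randomized, history- and instance-dependent rule for choosing the non-goal of $\mathrm{OPEN}_{\min}$ to expand. $E_{\alpha,\tau}(I;\rho)$ is the set of non-goal states expanded by the run with weight $\alpha$, tie-breaker $\tau$ and random outcome $\rho$. For $0\le\alpha<1$ and $h$ as in the claim, $E_{\alpha,\tau}(I;\rho)$ does not depend on $\tau$ or $\rho$ and is denoted $E_\alpha$. *)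

theory Defs
  imports Complex_Main "Graph_Theory.Pair_Digraph" "Graph_Theory.Shortest_Path"
begin

record 'v search_instance =
  graph :: "'v pair_pre_digraph"
  cost :: "'v \<times> 'v \<Rightarrow> real"
  start :: 'v
  goals :: "'v set"
  heur :: "'v \<Rightarrow> real"
  succs :: "'v \<Rightarrow> 'v list"

definition search_instance :: "'v search_instance \<Rightarrow> bool" where
  "search_instance I \<longleftrightarrow>
     pair_fin_digraph (graph I) \<and>
     (\<forall>a \<in> parcs (graph I). 0 \<le> cost I a) \<and>
     start I \<in> pverts (graph I) \<and> start I \<notin> goals I \<and> goals I \<subseteq> pverts (graph I) \<and>
     (\<forall>v \<in> pverts (graph I).
        distinct (succs I v) \<and> set (succs I v) = {w. (v, w) \<in> parcs (graph I)})"

text \<open>The constant \<open>wf_digraph.\<mu>\<close> is the infimum of the costs of the walks between two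
  vertices, and \<open>\<infinity>\<close> if there is none.\<close>

definition dist_from_start :: "'v search_instance \<Rightarrow> 'v \<Rightarrow> ereal" where
  "dist_from_start I v = wf_digraph.\<mu> (with_proj (graph I)) (cost I) (start I) v"

definition dist_to_goal :: "'v search_instance \<Rightarrow> 'v \<Rightarrow> ereal" where
  "dist_to_goal I v = (INF t \<in> goals I. wf_digraph.\<mu> (with_proj (graph I)) (cost I) v t)"

definition opt_cost :: "'v search_instance \<Rightarrow> ereal" where
  "opt_cost I = dist_to_goal I (start I)"

definition solvable :: "'v search_instance \<Rightarrow> bool" where
  "solvable I \<longleftrightarrow> opt_cost I < \<infinity>"

definition consistent :: "'v search_instance \<Rightarrow> bool" where
  "consistent I \<longleftrightarrow> (\<forall>(u, v) \<in> parcs (graph I). heur I u \<le> cost I (u, v) + heur I v)"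

definition S_le :: "'v search_instance \<Rightarrow> 'v set" where
  "S_le I = {v \<in> pverts (graph I) - goals I.
     reachable (with_proj (graph I)) (start I) v \<and>
     dist_from_start I v + ereal (heur I v) \<le> opt_cost I}"

record 'v entry =
  g_value :: real
  parent :: "'v option"
  timestamp :: nat
  is_goal :: bool

text \<open>The field \<open>inserted\<close> counts the insertions into OPEN made so far and supplies the timestamps.
  CLOSED keeps the entry with which a state was expanded.\<close>

record 'v search_state =
  OPEN :: "'v \<rightharpoonup> 'v entry"
  CLOSED :: "'v \<rightharpoonup> 'v entry"
  inserted :: nat

definition initial :: "'v search_instance \<Rightarrow> 'v search_state" where
  "initial I =
     \<lparr>OPEN = [start I \<mapsto> \<lparr>g_value = 0, parent = None, timestamp = 0, is_goal = False\<rparr>],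
      CLOSED = Map.empty, inserted = 1\<rparr>"

definition f_value :: "real \<Rightarrow> 'v search_instance \<Rightarrow> 'v search_state \<Rightarrow> 'v \<Rightarrow> real" where
  "f_value \<alpha> I \<sigma> v = g_value (the (OPEN \<sigma> v)) + \<alpha> * heur I v"

definition OPEN_min :: "real \<Rightarrow> 'v search_instance \<Rightarrow> 'v search_state \<Rightarrow> 'v set" where
  "OPEN_min \<alpha> I \<sigma> =
     {v \<in> dom (OPEN \<sigma>). \<forall>w \<in> dom (OPEN \<sigma>). f_value \<alpha> I \<sigma> v \<le> f_value \<alpha> I \<sigma> w}"

text \<open>The search ends when OPEN is empty (OPEN is finite along a run, so this is the case
  \<open>OPEN_min \<alpha> I \<sigma> = {}\<close>) or when a goal is minimal. Which minimal goal is then selected has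
  no influence on the set of expanded states.\<close>

definition finished :: "real \<Rightarrow> 'v search_instance \<Rightarrow> 'v search_state \<Rightarrow> bool" where
  "finished \<alpha> I \<sigma> \<longleftrightarrow> OPEN_min \<alpha> I \<sigma> = {} \<or> OPEN_min \<alpha> I \<sigma> \<inter> goals I \<noteq> {}"

text \<open>Generating \<open>w\<close> as a successor of \<open>v\<close>, where \<open>v\<close> was expanded with cost \<open>gv\<close>.
  States in CLOSED are not reopened.\<close>

definition generate ::
  "'v search_instance \<Rightarrow> 'v \<Rightarrow> real \<Rightarrow> 'v \<Rightarrow> 'v search_state \<Rightarrow> 'v search_state" where
  "generate I v gv w \<sigma> =
     (let t = gv + cost I (v, w) in
      if w \<in> dom (CLOSED \<sigma>) then \<sigma>
      else (case OPEN \<sigma> w of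
          None \<Rightarrow> \<sigma>\<lparr>OPEN := (OPEN \<sigma>)(w \<mapsto> \<lparr>g_value = t, parent = Some v,
                       timestamp = inserted \<sigma>, is_goal = (w \<in> goals I)\<rparr>),
                    inserted := inserted \<sigma> + 1\<rparr>
        | Some e \<Rightarrow>
            if t < g_value e
            then \<sigma>\<lparr>OPEN := (OPEN \<sigma>)(w \<mapsto> e\<lparr>g_value := t, parent := Some v\<rparr>)\<rparr>
            else \<sigma>))"

definition expand ::
  "'v search_instance \<Rightarrow> 'v \<Rightarrow> 'v search_state \<Rightarrow> 'v search_state" where
  "expand I v \<sigma> =
     fold (generate I v (g_value (the (OPEN \<sigma> v)))) (succs I v)
       (\<sigma>\<lparr>OPEN := (OPEN \<sigma>)(v := None), CLOSED := (CLOSED \<sigma>)(v := OPEN \<sigma> v)\<rparr>)"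

text \<open>A history lists the search states at the selection points so far, the current one last.
  A randomized tie-breaker with outcomes in \<open>'r\<close> is a family of such rules indexed by \<open>'r\<close>.\<close>

type_synonym 'v tie_rule = "'v search_instance \<Rightarrow> 'v search_state list \<Rightarrow> 'v"

text \<open>Legality is required on every nonempty list of search states, not only on those that occur
  in a run. This is no restriction: the choices elsewhere do not affect any run.\<close>

definition legal_rule :: "real \<Rightarrow> 'v tie_rule \<Rightarrow> bool" where
  "legal_rule \<alpha> r \<longleftrightarrow>
     (\<forall>I H. search_instance I \<longrightarrow> H \<noteq> [] \<longrightarrow> \<not> finished \<alpha> I (last H) \<longrightarrow>
        r I H \<in> OPEN_min \<alpha> I (last H) - goals I)"

definition tie_breaker :: "real \<Rightarrow> ('r \<Rightarrow> 'v tie_rule) \<Rightarrow> bool" where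
  "tie_breaker \<alpha> \<tau> \<longleftrightarrow> (\<forall>\<rho>. legal_rule \<alpha> (\<tau> \<rho>))"

text \<open>The history after \<open>n\<close> expansions; it is stationary once the search has ended.\<close>

primrec run ::
  "real \<Rightarrow> 'v tie_rule \<Rightarrow> 'v search_instance \<Rightarrow> nat \<Rightarrow> 'v search_state list" where
  "run \<alpha> r I 0 = [initial I]"
| "run \<alpha> r I (Suc n) =
     (let H = run \<alpha> r I n in
      if finished \<alpha> I (last H) then H else H @ [expand I (r I H) (last H)])"

definition expanded :: "real \<Rightarrow> 'v tie_rule \<Rightarrow> 'v search_instance \<Rightarrow> 'v set" where
  "expanded \<alpha> r I =
     {r I (run \<alpha> r I n) | n. \<not> finished \<alpha> I (last (run \<alpha> r I n))}"

text \<open>The common set of expanded states; meaningful only when it is independent of the rule.\<close>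

definition E_set :: "real \<Rightarrow> 'v search_instance \<Rightarrow> 'v set" where
  "E_set \<alpha> I = (THE S. \<forall>r. legal_rule \<alpha> r \<longrightarrow> expanded \<alpha> r I = S)"

lemma tie_breaker_exists: "\<exists>\<tau> :: 'r \<Rightarrow> 'v tie_rule. tie_breaker \<alpha> \<tau>"
proof -
  have "(SOME v. v \<in> OPEN_min \<alpha> I (last H) - goals I) \<in> OPEN_min \<alpha> I (last H) - goals I"
    if "\<not> finished \<alpha> I (last H)" for I :: "'v search_instance" and H
  proof -
    from that obtain v where "v \<in> OPEN_min \<alpha> I (last H) - goals I"
      unfolding finished_def by blast
    then show ?thesis by (rule someI)
  qed
  then have "tie_breaker \<alpha>
      (\<lambda>(\<rho> :: 'r) (I :: 'v search_instance) H. SOME v. v \<in> OPEN_min \<alpha> I (last H) - goals I)"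
    unfolding tie_breaker_def legal_rule_def by blast
  then show ?thesis by blast
qed

end

theory Submission
  imports Defs
begin

text \<open>
  For \<open>\<alpha> \<le> 1\<close> the function \<open>\<alpha> h\<close> is consistent. On any walk from the start to a state that is
  not yet closed, some open state has an \<open>f\<close>-value at most the cost of the walk plus \<open>\<alpha> h\<close> at its
  end. Hence a selected state \<open>v\<close> has \<open>g(v) = g\<^sup>*(v)\<close> and \<open>g\<^sup>*(v) + \<alpha> h(v) \<le> C\<^sup>*\<close>, and, when the
  search stops, all \<open>v \<notin> \<G>\<close> with \<open>g\<^sup>*(v) + \<alpha> h(v) < C\<^sup>*\<close> are closed. For \<open>\<alpha> < 1\<close> a non-goal
  state on an optimal solution has \<open>f\<close>-value strictly below \<open>C\<^sup>*\<close>, because \<open>0 < h \<le> h\<^sup>*\<close> there, so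
  goal preference stops the search before a state with \<open>f\<close>-value \<open>C\<^sup>*\<close> is expanded. Therefore
  \<open>E\<^sub>\<alpha> = {v \<notin> \<G>. g\<^sup>*(v) + \<alpha> h(v) < C\<^sup>*}\<close>, from which all inclusions follow.
\<close>

section \<open>Effect of generating successors on the stored costs\<close>

text \<open>OPEN and CLOSED are treated alike so that a bound, once established, survives the move
  of a state from OPEN to CLOSED.\<close>

definition label_le :: "'v search_state \<Rightarrow> 'v \<Rightarrow> real \<Rightarrow> bool" where
  "label_le \<sigma> w x \<longleftrightarrow> (\<exists>e. (OPEN \<sigma> w = Some e \<or> CLOSED \<sigma> w = Some e) \<and> g_value e \<le> x)"

lemma CLOSED_generate [simp]: "CLOSED (generate I v gv w \<sigma>) = CLOSED \<sigma>"
  by (simp add: generate_def Let_def split: option.split)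

lemma CLOSED_fold_generate [simp]: "CLOSED (fold (generate I v gv) ws \<sigma>) = CLOSED \<sigma>"
  by (induction ws arbitrary: \<sigma>) simp_all

text \<open>An existing entry is replaced only when its cost strictly decreases, and no entry is
  removed.\<close>

lemma label_le_generate_mono:
  "label_le \<sigma> u x \<Longrightarrow> label_le (generate I v gv w \<sigma>) u x"
  by (auto simp: label_le_def generate_def Let_def split: option.splits)

lemma label_le_fold_generate_mono:
  "label_le \<sigma> u x \<Longrightarrow> label_le (fold (generate I v gv) ws \<sigma>) u x"
  by (induction ws arbitrary: \<sigma>) (simp_all add: label_le_generate_mono)

text \<open>Since closed states are not reopened, a closed \<open>w\<close> must satisfy the bound
  beforehand; an open or new \<open>w\<close> receives it from the update or insertion.\<close>

lemma label_le_generate: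
  assumes "\<And>e. CLOSED \<sigma> w = Some e \<Longrightarrow> g_value e \<le> gv + cost I (v, w)"
  shows "label_le (generate I v gv w \<sigma>) w (gv + cost I (v, w))"
  using assms by (auto simp: label_le_def generate_def Let_def split: option.splits)

lemma label_le_fold_generate:
  assumes "w \<in> set ws" "\<And>e. CLOSED \<sigma> w = Some e \<Longrightarrow> g_value e \<le> gv + cost I (v, w)"
  shows "label_le (fold (generate I v gv) ws \<sigma>) w (gv + cost I (v, w))"
  using assms
proof (induction ws arbitrary: \<sigma>)
  case (Cons a ws)
  show ?case
  proof (cases "a = w")
    case True
    then show ?thesis
      using Cons.prems(2) by (simp add: label_le_fold_generate_mono label_le_generate)
  next
    case False
    then show ?thesis using Cons.IH[of "generate I v gv a \<sigma>"] Cons.prems by simp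
  qed
qed simp

lemma OPEN_generateD:
  assumes "OPEN (generate I v gv w \<sigma>) u = Some e"
  shows "(\<exists>e'. OPEN \<sigma> u = Some e' \<and> g_value e' = g_value e) \<or>
    u = w \<and> u \<notin> dom (CLOSED \<sigma>) \<and> g_value e = gv + cost I (v, u)"
  using assms
  by (auto simp: generate_def Let_def domIff split: option.splits if_splits)

text \<open>Traces each open cost back to its origin, for the preservation of disjointness and of
  the walks behind open costs.\<close>

lemma OPEN_fold_generateD:
  assumes "OPEN (fold (generate I v gv) ws \<sigma>) u = Some e"
  shows "(\<exists>e'. OPEN \<sigma> u = Some e' \<and> g_value e' = g_value e) \<or>
    u \<in> set ws \<and> u \<notin> dom (CLOSED \<sigma>) \<and> g_value e = gv + cost I (v, u)"
  using assms
proof (induction ws arbitrary: \<sigma>)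
  case (Cons a ws)
  from Cons.IH[of "generate I v gv a \<sigma>"] Cons.prems
  consider e' where "OPEN (generate I v gv a \<sigma>) u = Some e'" "g_value e' = g_value e"
    | "u \<in> set ws" "u \<notin> dom (CLOSED \<sigma>)" "g_value e = gv + cost I (v, u)"
    by auto
  then show ?case
  proof cases
    case 1
    from OPEN_generateD[OF this(1)] this(2) show ?thesis by auto
  qed auto
qed simp

lemma expand_eq:
  assumes "OPEN \<sigma> v = Some e"
  shows "expand I v \<sigma> = fold (generate I v (g_value e)) (succs I v)
    (\<sigma>\<lparr>OPEN := (OPEN \<sigma>)(v := None), CLOSED := (CLOSED \<sigma>)(v \<mapsto> e)\<rparr>)"
  using assms by (simp add: expand_def)

lemma CLOSED_expand [simp]: "CLOSED (expand I v \<sigma>) = (CLOSED \<sigma>)(v := OPEN \<sigma> v)"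
  by (simp add: expand_def)

section \<open>Walks, distances and the consistent heuristic\<close>

locale positive_consistent_search =
  fixes I :: "'v search_instance"
  assumes search_instance: "search_instance I"
    and solvable: "solvable I"
    and consistent: "consistent I"
    and heur_goal: "v \<in> goals I \<Longrightarrow> heur I v = 0"
    and heur_pos: "v \<in> pverts (graph I) \<Longrightarrow> v \<notin> goals I \<Longrightarrow> 0 < heur I v"
begin

sublocale pair_fin_digraph "graph I"
  using search_instance by (simp add: search_instance_def)

lemma cost_nonneg: "a \<in> parcs (graph I) \<Longrightarrow> 0 \<le> cost I a"
  and start_in_verts: "start I \<in> pverts (graph I)"
  and goals_subset: "goals I \<subseteq> pverts (graph I)"
  and set_succs: "v \<in> pverts (graph I) \<Longrightarrow> set (succs I v) = {w. (v, w) \<in> parcs (graph I)}"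
  using search_instance by (auto simp: search_instance_def)

lemma heur_nonneg: "v \<in> pverts (graph I) \<Longrightarrow> 0 \<le> heur I v"
  using heur_goal heur_pos by (cases "v \<in> goals I") (auto intro: less_imp_le)

lemma heur_arc: "(u, v) \<in> parcs (graph I) \<Longrightarrow> heur I u \<le> cost I (u, v) + heur I v"
  using consistent by (auto simp: consistent_def)

text \<open>The arc inequalities of consistency telescope along the walk.\<close>

lemma heur_walk:
  assumes "awalk u p v"
  shows "heur I u \<le> awalk_cost (cost I) p + heur I v"
  using assms
proof (induction p arbitrary: u)
  case (Cons a p)
  obtain b where "a = (u, b)" "(u, b) \<in> parcs (graph I)" "awalk b p v"
    using Cons.prems by (cases a) (auto simp: awalk_Cons_iff)
  then show ?case using Cons.IH[of b] heur_arc[of u b] by simp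
qed (simp add: awalk_Nil_iff)

lemma dist_le_walk: "awalk (start I) p v \<Longrightarrow> dist_from_start I v \<le> awalk_cost (cost I) p"
  unfolding dist_from_start_def by (rule min_cost_le_walk_cost)

text \<open>Nonnegative costs exclude negative cycles, so the infimum over walks is attained by a
  path. Extended real distances can thus be replaced by real walk costs.\<close>

lemma mu_attained:
  assumes "\<mu> (cost I) u v < \<infinity>"
  obtains p where "awalk u p v" "\<mu> (cost I) u v = awalk_cost (cost I) p"
proof -
  have "\<exists>p. apath u p v \<and> \<mu> (cost I) u v = awalk_cost (cost I) p"
  proof (rule no_neg_cyc_reach_imp_path)
    show "reachable (with_proj (graph I)) u v" using assms \<mu>_reach_conv by blast
    show "\<not> (\<exists>w c. awalk w c w \<and> w \<in> set (pawalk_verts u p) \<and> awalk_cost (cost I) c < 0)" for p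
      using pos_cost_pos_awalk_cost cost_nonneg by (meson not_less)
  qed
  then show thesis using that by (auto simp: apath_def)
qed

lemma dist_eq_walk:
  assumes "reachable (with_proj (graph I)) (start I) v"
  obtains p where "awalk (start I) p v" "dist_from_start I v = awalk_cost (cost I) p"
  using assms mu_attained[of "start I" v] \<mu>_reach_conv
  unfolding dist_from_start_def by blast

lemma opt_cost_le_walk:
  assumes "awalk (start I) p t" "t \<in> goals I"
  shows "opt_cost I \<le> awalk_cost (cost I) p"
  unfolding opt_cost_def dist_to_goal_def
  using assms(2) min_cost_le_walk_cost[OF assms(1)] by (rule INF_lower2)

text \<open>There are only finitely many goals, so one of them attains the outer infimum;
  \<open>mu_attained\<close> then gives an optimal walk to it.\<close>

lemma opt_cost_attained:
  obtains p t where "awalk (start I) p t" "t \<in> goals I"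
    "opt_cost I = awalk_cost (cost I) p"
proof -
  have fin: "finite (goals I)"
    using goals_subset pair_finite_verts finite_subset by blast
  have lt: "(INF t \<in> goals I. \<mu> (cost I) (start I) t) < \<infinity>"
    using solvable by (simp add: solvable_def opt_cost_def dist_to_goal_def)
  \<comment> \<open>An infimum over the empty set would be \<infinity>, contradicting
    solvability.\<close>
  then have "goals I \<noteq> {}" by (auto simp: top_ereal_def)
  from finite_INF_in[OF fin this] obtain t
    where "t \<in> goals I" "opt_cost I = \<mu> (cost I) (start I) t"
    by (fastforce simp: opt_cost_def dist_to_goal_def)
  moreover from this lt have "\<mu> (cost I) (start I) t < \<infinity>"
    by (simp add: opt_cost_def dist_to_goal_def)
  ultimately show thesis using mu_attained that by metis
qed

section \<open>Invariant of the search and the frontier argument\<close>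

text \<open>Open costs are witnessed by walks, so they never undercut the true distance. Minimality
  of closed costs makes it harmless to discard duplicates of closed states. The two label clauses
  say that the start and all arcs leaving CLOSED have been relaxed, which is what
  \<open>frontier\<close> propagates.\<close>

definition search_invar :: "'v search_state \<Rightarrow> bool" where
  "search_invar \<sigma> \<longleftrightarrow>
     dom (OPEN \<sigma>) \<inter> dom (CLOSED \<sigma>) = {} \<and>
     dom (CLOSED \<sigma>) \<subseteq> pverts (graph I) - goals I \<and>
     (\<forall>v e. OPEN \<sigma> v = Some e \<longrightarrow>
        (\<exists>p. awalk (start I) p v \<and> g_value e = awalk_cost (cost I) p)) \<and>
     (\<forall>v e p. CLOSED \<sigma> v = Some e \<longrightarrow> awalk (start I) p v \<longrightarrow>
        g_value e \<le> awalk_cost (cost I) p) \<and>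
     label_le \<sigma> (start I) 0 \<and>
     (\<forall>u e w. CLOSED \<sigma> u = Some e \<longrightarrow> (u, w) \<in> parcs (graph I) \<longrightarrow>
        label_le \<sigma> w (g_value e + cost I (u, w)))"

lemma search_invar_initial: "search_invar (initial I)"
proof -
  have "awalk (start I) [] (start I) \<and> (0::real) = awalk_cost (cost I) []"
    using start_in_verts by (simp add: awalk_Nil_iff)
  then have "\<exists>p. awalk (start I) p v \<and> g_value e = awalk_cost (cost I) p"
    if "OPEN (initial I) v = Some e" for v e
    using that by (intro exI[of _ "[]"]) (auto simp: initial_def split: if_splits)
  moreover have "label_le (initial I) (start I) 0"
    by (simp add: label_le_def initial_def)
  moreover have "CLOSED (initial I) = Map.empty"
    by (simp add: initial_def)
  ultimately show ?thesis
    unfolding search_invar_def by simp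
qed

lemma search_invarD:
  assumes "search_invar \<sigma>"
  shows disjoint: "dom (OPEN \<sigma>) \<inter> dom (CLOSED \<sigma>) = {}"
    and CLOSED_non_goals: "dom (CLOSED \<sigma>) \<subseteq> pverts (graph I) - goals I"
    and CLOSED_le: "\<And>v e p. CLOSED \<sigma> v = Some e \<Longrightarrow> awalk (start I) p v \<Longrightarrow>
        g_value e \<le> awalk_cost (cost I) p"
    and label_start: "label_le \<sigma> (start I) 0"
    and label_succ: "\<And>u e w. CLOSED \<sigma> u = Some e \<Longrightarrow> (u, w) \<in> parcs (graph I) \<Longrightarrow>
        label_le \<sigma> w (g_value e + cost I (u, w))"
  using assms unfolding search_invar_def by blast+

lemma OPEN_walk:
  assumes "search_invar \<sigma>" "OPEN \<sigma> v = Some e"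
  obtains p where "awalk (start I) p v" "g_value e = awalk_cost (cost I) p"
  using assms that unfolding search_invar_def by blast

lemma finite_dom_OPEN:
  assumes "search_invar \<sigma>"
  shows "finite (dom (OPEN \<sigma>))"
proof (rule finite_subset[OF _ pair_finite_verts])
  show "dom (OPEN \<sigma>) \<subseteq> pverts (graph I)"
  proof
    fix v assume "v \<in> dom (OPEN \<sigma>)"
    then obtain e where "OPEN \<sigma> v = Some e" by (auto dest: domD)
    from OPEN_walk[OF assms this] obtain p where "awalk (start I) p v" .
    then show "v \<in> pverts (graph I)" by (rule awalk_last_in_verts)
  qed
qed

text \<open>Walk along \<open>p\<close> with the current label: at an open state stop; at a closed
  one the next arc has been relaxed, so the bound passes on. The end \<open>v\<close> is not closed,
  so an open state is met at the latest there. The remaining walk \<open>q\<close> is kept for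
  comparison with the heuristic.\<close>

lemma frontier:
  assumes inv: "search_invar \<sigma>" and v: "v \<notin> dom (CLOSED \<sigma>)"
    and "awalk u p v" "label_le \<sigma> u x"
  obtains w e q where "OPEN \<sigma> w = Some e" "awalk w q v"
    "g_value e + awalk_cost (cost I) q \<le> x + awalk_cost (cost I) p"
proof -
  have "\<exists>w e q. OPEN \<sigma> w = Some e \<and> awalk w q v \<and>
    g_value e + awalk_cost (cost I) q \<le> x + awalk_cost (cost I) p"
    using assms(3,4)
  proof (induction p arbitrary: u x)
    case Nil
    then obtain e where "OPEN \<sigma> v = Some e" "g_value e \<le> x" "awalk v [] v"
      using v by (auto simp: label_le_def awalk_Nil_iff)
    then show ?case by fastforce
  next
    case (Cons a p)
    obtain b where b: "a = (u, b)" "(u, b) \<in> parcs (graph I)" "awalk b p v"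
      using Cons.prems(1) by (cases a) (auto simp: awalk_Cons_iff)
    from Cons.prems(2) obtain e where e: "g_value e \<le> x"
      and "OPEN \<sigma> u = Some e \<or> CLOSED \<sigma> u = Some e"
      by (auto simp: label_le_def)
    then show ?case
    proof (elim disjE)
      assume "OPEN \<sigma> u = Some e"
      then show ?thesis using Cons.prems(1) e add_right_mono by blast
    next
      assume "CLOSED \<sigma> u = Some e"
      then have "label_le \<sigma> b (g_value e + cost I (u, b))"
        using inv b(2) by (simp add: label_succ)
      from Cons.IH[OF b(3) this] obtain w d q where "OPEN \<sigma> w = Some d" "awalk w q v"
        "g_value d + awalk_cost (cost I) q \<le> g_value e + cost I (u, b) + awalk_cost (cost I) p"
        by blast
      moreover from this(3) e have "g_value d + awalk_cost (cost I) q \<le> x + awalk_cost (cost I) (a # p)"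
        by (simp add: b(1))
      ultimately show ?thesis by blast
    qed
  qed
  then show thesis using that by blast
qed

lemma start_frontier:
  assumes "search_invar \<sigma>" "v \<notin> dom (CLOSED \<sigma>)" "awalk (start I) p v"
  obtains w e q where "OPEN \<sigma> w = Some e" "awalk w q v"
    "g_value e + awalk_cost (cost I) q \<le> awalk_cost (cost I) p"
  by (rule frontier[OF assms label_start[OF assms(1)]]) (rule that, simp_all)

end

section \<open>Optimality of selected states\<close>

locale search_run = positive_consistent_search I
  for I :: "'v search_instance" +
  fixes \<alpha> :: real and r :: "'v tie_rule"
  assumes weight: "0 \<le> \<alpha>" "\<alpha> \<le> 1"
    and legal: "legal_rule \<alpha> r"
begin

text \<open>With \<open>q\<close> the rest of the walk after the open state \<open>w\<close>,
  consistency scaled by \<alpha> bounds the heuristic term of \<open>w\<close> by \<alpha> times the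
  cost of \<open>q\<close> plus that of \<open>v\<close>; as \<alpha> \<le> 1 and costs are
  nonnegative, the cost of \<open>q\<close> itself suffices.\<close>

lemma frontier_f_value:
  assumes "search_invar \<sigma>" "v \<notin> dom (CLOSED \<sigma>)" "awalk (start I) p v"
  obtains w where "w \<in> dom (OPEN \<sigma>)"
    "f_value \<alpha> I \<sigma> w \<le> awalk_cost (cost I) p + \<alpha> * heur I v"
proof -
  obtain w e q where w: "OPEN \<sigma> w = Some e" "awalk w q v"
    and le: "g_value e + awalk_cost (cost I) q \<le> awalk_cost (cost I) p"
    using start_frontier[OF assms] .
  have "0 \<le> awalk_cost (cost I) q"
    using pos_cost_pos_awalk_cost[OF w(2)] cost_nonneg by blast
  then have "\<alpha> * awalk_cost (cost I) q \<le> awalk_cost (cost I) q"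
    using weight by (simp add: mult_left_le_one_le)
  moreover have "\<alpha> * heur I w \<le> \<alpha> * awalk_cost (cost I) q + \<alpha> * heur I v"
    using mult_left_mono[OF heur_walk[OF w(2)] weight(1)] by (simp add: algebra_simps)
  ultimately show thesis
    using that[of w] w(1) le by (auto simp: f_value_def)
qed

text \<open>Minimality of \<open>v\<close> against the frontier state of the walk; the heuristic
  term of \<open>v\<close> then cancels on both sides.\<close>

lemma selected_optimal:
  assumes "search_invar \<sigma>" "v \<in> OPEN_min \<alpha> I \<sigma>" "OPEN \<sigma> v = Some e"
    and "awalk (start I) p v"
  shows "g_value e \<le> awalk_cost (cost I) p"
proof -
  have "v \<notin> dom (CLOSED \<sigma>)" using disjoint[OF assms(1)] assms(3) by blast
  from frontier_f_value[OF assms(1) this assms(4)] obtain w where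
    "w \<in> dom (OPEN \<sigma>)" "f_value \<alpha> I \<sigma> w \<le> awalk_cost (cost I) p + \<alpha> * heur I v" .
  moreover from this(1) assms(2) have "f_value \<alpha> I \<sigma> v \<le> f_value \<alpha> I \<sigma> w"
    by (simp add: OPEN_min_def)
  ultimately show ?thesis using assms(3) by (simp add: f_value_def)
qed

lemma search_invar_expand:
  assumes inv: "search_invar \<sigma>" and v: "v \<in> OPEN_min \<alpha> I \<sigma> - goals I"
  shows "search_invar (expand I v \<sigma>)"
proof -
  from v obtain e where e: "OPEN \<sigma> v = Some e" by (auto simp: OPEN_min_def)
  define \<sigma>0 where "\<sigma>0 = \<sigma>\<lparr>OPEN := (OPEN \<sigma>)(v := None), CLOSED := (CLOSED \<sigma>)(v \<mapsto> e)\<rparr>"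
  define \<sigma>' where "\<sigma>' = expand I v \<sigma>"
  have \<sigma>': "\<sigma>' = fold (generate I v (g_value e)) (succs I v) \<sigma>0"
    using e by (simp add: \<sigma>'_def \<sigma>0_def expand_eq)
  have closed: "CLOSED \<sigma>' = (CLOSED \<sigma>)(v \<mapsto> e)" using e by (simp add: \<sigma>'_def)
  have v_open: "v \<notin> dom (CLOSED \<sigma>)" using disjoint[OF inv] e by blast
  have g_v: "g_value e \<le> awalk_cost (cost I) p" if "awalk (start I) p v" for p
    using selected_optimal[OF inv _ e that] v by blast
  obtain p where p: "awalk (start I) p v" "g_value e = awalk_cost (cost I) p"
    using OPEN_walk[OF inv e] .
  then have v_vert: "v \<in> pverts (graph I)" using awalk_last_in_verts by auto
  \<comment> \<open>These extended walks witness the costs of newly opened or improved successors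
    and bound the costs of closed ones.\<close>
  have walk_succ: "awalk (start I) (p @ [(v, w)]) w"
    "awalk_cost (cost I) (p @ [(v, w)]) = g_value e + cost I (v, w)"
    if "(v, w) \<in> parcs (graph I)" for w
  proof -
    have "awalk v [(v, w)] w" using arc_implies_awalk[OF that] by simp
    with p(1) show "awalk (start I) (p @ [(v, w)]) w" by (rule awalk_appendI)
  qed (use p(2) in simp)
  have closed_min: "g_value d \<le> awalk_cost (cost I) q"
    if "CLOSED \<sigma>' u = Some d" "awalk (start I) q u" for u d q
  proof (cases "u = v")
    case True
    then show ?thesis using that g_v by (simp add: closed)
  next
    case False
    then have "CLOSED \<sigma> u = Some d" using that(1) by (simp add: closed)
    then show ?thesis using CLOSED_le[OF inv] that(2) by blast
  qed
  have label_mono: "label_le \<sigma>' u x" if "label_le \<sigma> u x" for u x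
  proof -
    \<comment> \<open>Only \<open>v\<close> moves, and it keeps its entry \<open>e\<close>. Since
      \<open>v\<close> was not closed before, no older label of \<open>v\<close> is
      overwritten.\<close>
    have "label_le \<sigma>0 u x"
      using that e v_open by (cases "u = v") (auto simp: label_le_def \<sigma>0_def)
    then show ?thesis unfolding \<sigma>' by (rule label_le_fold_generate_mono)
  qed
  have disjoint': "dom (OPEN \<sigma>') \<inter> dom (CLOSED \<sigma>') = {}"
  proof -
    have "u \<notin> dom (CLOSED \<sigma>')" if "OPEN \<sigma>' u = Some d" for u d
      using OPEN_fold_generateD[OF that[unfolded \<sigma>']]
    proof (elim disjE exE conjE)
      fix d' assume "OPEN \<sigma>0 u = Some d'"
      then have "u \<noteq> v" "u \<in> dom (OPEN \<sigma>)" by (auto simp: \<sigma>0_def split: if_splits)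
      then show ?thesis using disjoint[OF inv] by (auto simp: closed)
    qed (simp add: \<sigma>')
    then show ?thesis by blast
  qed
  have non_goals: "dom (CLOSED \<sigma>') \<subseteq> pverts (graph I) - goals I"
    using CLOSED_non_goals[OF inv] v v_vert by (simp add: closed)
  have open_walk: "\<exists>q. awalk (start I) q u \<and> g_value d = awalk_cost (cost I) q"
    if "OPEN \<sigma>' u = Some d" for u d
    using OPEN_fold_generateD[OF that[unfolded \<sigma>']]
  proof (elim disjE exE conjE)
    fix d' assume "OPEN \<sigma>0 u = Some d'" "g_value d' = g_value d"
    then have "OPEN \<sigma> u = Some d'" by (simp add: \<sigma>0_def split: if_splits)
    from OPEN_walk[OF inv this] obtain q
      where "awalk (start I) q u" "g_value d' = awalk_cost (cost I) q" .
    then show ?thesis using \<open>g_value d' = g_value d\<close> by auto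
  next
    assume "u \<in> set (succs I v)" "g_value d = g_value e + cost I (v, u)"
    then show ?thesis using walk_succ[of u] set_succs[OF v_vert] by (metis mem_Collect_eq)
  qed
  have label_start': "label_le \<sigma>' (start I) 0"
    using label_mono[OF label_start[OF inv]] .
  have label_succ': "label_le \<sigma>' w (g_value d + cost I (u, w))"
    if "CLOSED \<sigma>' u = Some d" "(u, w) \<in> parcs (graph I)" for u d w
  proof (cases "u = v")
    case True
    then have d: "d = e" using that(1) by (simp add: closed)
    have "w \<in> set (succs I v)" using that(2) True set_succs[OF v_vert] by simp
    \<comment> \<open>A closed successor, possibly \<open>v\<close> itself through a loop, keeps its
      cost, which is minimal and hence at most that of the walk through \<open>v\<close>.\<close>
    moreover have "g_value c \<le> g_value e + cost I (v, w)" if "CLOSED \<sigma>0 w = Some c" for c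
    proof -
      have "CLOSED \<sigma>' w = Some c" using that by (simp add: \<sigma>')
      moreover have "(v, w) \<in> parcs (graph I)" using \<open>(u, w) \<in> parcs (graph I)\<close> True by simp
      ultimately show ?thesis using closed_min walk_succ by metis
    qed
    ultimately show ?thesis
      unfolding \<sigma>' True d by (rule label_le_fold_generate)
  next
    case False
    then have "CLOSED \<sigma> u = Some d" using that(1) by (simp add: closed)
    then show ?thesis using label_mono[OF label_succ[OF inv]] that(2) by blast
  qed
  show ?thesis
    unfolding search_invar_def \<sigma>'_def[symmetric]
    by (intro conjI allI impI)
      (rule disjoint' non_goals open_walk closed_min label_start' label_succ'; assumption)+
qed

section \<open>Runs and termination\<close>

abbreviation state :: "nat \<Rightarrow> 'v search_state" where
  "state n \<equiv> last (run \<alpha> r I n)"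

abbreviation choice :: "nat \<Rightarrow> 'v" where
  "choice n \<equiv> r I (run \<alpha> r I n)"

lemma run_nonempty: "run \<alpha> r I n \<noteq> []"
  by (induction n) (simp_all add: Let_def)

lemma choice_selected:
  "\<not> finished \<alpha> I (state n) \<Longrightarrow> choice n \<in> OPEN_min \<alpha> I (state n) - goals I"
  using legal search_instance run_nonempty by (simp add: legal_rule_def)

lemma state_Suc:
  "state (Suc n) =
    (if finished \<alpha> I (state n) then state n else expand I (choice n) (state n))"
  by (simp add: Let_def)

lemma search_invar_state: "search_invar (state n)"
proof (induction n)
  case 0
  show ?case using search_invar_initial by simp
next
  case (Suc n)
  then show ?case
    using choice_selected search_invar_expand by (auto simp only: state_Suc split: if_splits)
qed

text \<open>CLOSED starts empty and gains only the chosen state at each step. This lets membership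
  in the final CLOSED set prove that a state is expanded.\<close>

lemma dom_CLOSED_subset_expanded: "dom (CLOSED (state n)) \<subseteq> expanded \<alpha> r I"
proof (induction n)
  case 0
  show ?case by (simp add: initial_def)
next
  case (Suc n)
  show ?case
  proof (cases "finished \<alpha> I (state n)")
    case True
    then show ?thesis using Suc by (simp only: state_Suc if_True)
  next
    case False
    then have "choice n \<in> expanded \<alpha> r I" unfolding expanded_def by blast
    moreover have "dom (CLOSED (state (Suc n))) \<subseteq> insert (choice n) (dom (CLOSED (state n)))"
      using False by (auto simp only: state_Suc if_False CLOSED_expand fun_upd_apply split: if_splits)
    ultimately show ?thesis using Suc by blast
  qed
qed

text \<open>The chosen state is open, hence by disjointness not yet closed; this gives the
  termination measure.\<close>

lemma card_CLOSED_Suc: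
  assumes "\<not> finished \<alpha> I (state n)"
  shows "card (dom (CLOSED (state (Suc n)))) = Suc (card (dom (CLOSED (state n))))"
proof -
  obtain e where e: "OPEN (state n) (choice n) = Some e"
    using choice_selected[OF assms] by (auto simp: OPEN_min_def)
  have "finite (dom (CLOSED (state n)))"
    using CLOSED_non_goals[OF search_invar_state] pair_finite_verts
    by (meson Diff_subset finite_subset)
  moreover have "choice n \<notin> dom (CLOSED (state n))"
    using disjoint[OF search_invar_state] e by blast
  moreover have "CLOSED (state (Suc n)) = (CLOSED (state n))(choice n \<mapsto> e)"
    using assms e by (simp only: state_Suc if_False CLOSED_expand)
  ultimately show ?thesis by (simp only: dom_fun_upd) (simp add: insert_absorb)
qed

lemma terminates: "\<exists>n. finished \<alpha> I (state n)"
proof (rule ccontr)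
  assume "\<nexists>n. finished \<alpha> I (state n)"
  \<comment> \<open>In an endless run CLOSED would contain exactly \<open>n\<close> states after
    \<open>n\<close> steps, exceeding the number of vertices.\<close>
  then have "card (dom (CLOSED (state n))) = n" for n
  proof (induction n)
    case 0
    show ?case by (simp add: initial_def)
  next
    case (Suc n)
    then show ?case using card_CLOSED_Suc by metis
  qed
  moreover have "card (dom (CLOSED (state n))) \<le> card (pverts (graph I))" for n
    using CLOSED_non_goals[OF search_invar_state] pair_finite_verts
    by (intro card_mono) blast+
  ultimately show False by (metis Suc_n_not_le_n)
qed

lemma OPEN_min_nonempty:
  assumes "finite (dom (OPEN \<sigma>))" "dom (OPEN \<sigma>) \<noteq> {}"
  shows "OPEN_min \<alpha> I \<sigma> \<noteq> {}"
  using ex_min_if_finite[of "f_value \<alpha> I \<sigma> ` dom (OPEN \<sigma>)"] assms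
  by (fastforce simp: OPEN_min_def not_less)

section \<open>Expanded states as a strict sublevel set\<close>

lemma expanded_cases:
  assumes "v \<in> expanded \<alpha> r I"
  obtains n where "\<not> finished \<alpha> I (state n)" "v \<in> OPEN_min \<alpha> I (state n)"
    "v \<in> pverts (graph I) - goals I" "reachable (with_proj (graph I)) (start I) v"
    "dist_from_start I v + ereal (\<alpha> * heur I v) = f_value \<alpha> I (state n) v"
proof -
  from assms obtain n where n: "v = choice n" "\<not> finished \<alpha> I (state n)"
    by (auto simp: expanded_def)
  note inv = search_invar_state[of n]
  have v: "v \<in> OPEN_min \<alpha> I (state n)" "v \<notin> goals I" using choice_selected n by auto
  then obtain e where e: "OPEN (state n) v = Some e" by (auto simp: OPEN_min_def)
  obtain p where p: "awalk (start I) p v" "g_value e = awalk_cost (cost I) p"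
    using OPEN_walk[OF inv e] .
  have reach: "reachable (with_proj (graph I)) (start I) v" using p(1) by (rule reachable_awalkI)
  obtain q where q: "awalk (start I) q v" "dist_from_start I v = awalk_cost (cost I) q"
    using dist_eq_walk[OF reach] .
  \<comment> \<open>The walk \<open>p\<close> behind the open entry gives one inequality, optimality
    against the shortest walk \<open>q\<close> the other.\<close>
  have "dist_from_start I v = g_value e"
    using dist_le_walk[OF p(1)] selected_optimal[OF inv v(1) e q(1)] p(2) q(2) by simp
  then show thesis
    using that[of n] n v e p(1) reach awalk_last_in_verts by (auto simp: f_value_def)
qed

text \<open>A goal is never closed, so an optimal walk to \<open>t\<close> always has a frontier
  state; as \<open>t\<close> has heuristic value 0, its evaluation is at most the optimal
  cost.\<close>

lemma expanded_le_opt_cost: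
  assumes "v \<in> expanded \<alpha> r I"
  shows "dist_from_start I v + ereal (\<alpha> * heur I v) \<le> opt_cost I"
proof -
  from assms obtain n where min: "v \<in> OPEN_min \<alpha> I (state n)"
    and f: "dist_from_start I v + ereal (\<alpha> * heur I v) = f_value \<alpha> I (state n) v"
    by (rule expanded_cases)
  obtain p t where p: "awalk (start I) p t" "t \<in> goals I" "opt_cost I = awalk_cost (cost I) p"
    by (rule opt_cost_attained)
  note inv = search_invar_state[of n]
  have "t \<notin> dom (CLOSED (state n))" using CLOSED_non_goals[OF inv] p(2) by blast
  from frontier_f_value[OF inv this p(1)] obtain w where
    "w \<in> dom (OPEN (state n))" "f_value \<alpha> I (state n) w \<le> awalk_cost (cost I) p"
    using heur_goal[OF p(2)] by auto
  then have "f_value \<alpha> I (state n) v \<le> awalk_cost (cost I) p"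
    using min by (force simp: OPEN_min_def)
  then show ?thesis by (simp add: f p(3))
qed

text \<open>The frontier state \<open>w\<close> of an optimal solution yields strictness in either
  case: by goal preference if it is a goal, by positivity of the heuristic and \<alpha> < 1
  otherwise.\<close>

lemma expanded_less_opt_cost:
  assumes "v \<in> expanded \<alpha> r I" "\<alpha> < 1"
  shows "dist_from_start I v + ereal (\<alpha> * heur I v) < opt_cost I"
proof -
  from assms(1) obtain n where unf: "\<not> finished \<alpha> I (state n)"
    and min: "v \<in> OPEN_min \<alpha> I (state n)"
    and f: "dist_from_start I v + ereal (\<alpha> * heur I v) = f_value \<alpha> I (state n) v"
    by (rule expanded_cases)
  obtain p t where p: "awalk (start I) p t" "t \<in> goals I" "opt_cost I = awalk_cost (cost I) p"
    by (rule opt_cost_attained)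
  note inv = search_invar_state[of n]
  have "t \<notin> dom (CLOSED (state n))" using CLOSED_non_goals[OF inv] p(2) by blast
  from start_frontier[OF inv this p(1)] obtain w e q where w: "OPEN (state n) w = Some e"
    "awalk w q t" and le: "g_value e + awalk_cost (cost I) q \<le> awalk_cost (cost I) p" .
  have h_w: "heur I w \<le> awalk_cost (cost I) q"
    using heur_walk[OF w(2)] heur_goal[OF p(2)] by simp
  have v_le: "f_value \<alpha> I (state n) v \<le> f_value \<alpha> I (state n) w"
    using min w(1) by (auto simp: OPEN_min_def)
  have "f_value \<alpha> I (state n) v < awalk_cost (cost I) p"
  proof (cases "w \<in> goals I")
    case True
    \<comment> \<open>The search has not stopped, so no goal is minimal and \<open>v\<close> lies
      strictly below \<open>w\<close>.\<close>
    then have "w \<notin> OPEN_min \<alpha> I (state n)" using unf by (auto simp: finished_def)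
    moreover have "w \<in> OPEN_min \<alpha> I (state n)"
      if "f_value \<alpha> I (state n) w \<le> f_value \<alpha> I (state n) v"
      using that min w(1) by (auto simp: OPEN_min_def intro: order_trans)
    ultimately have "f_value \<alpha> I (state n) v < f_value \<alpha> I (state n) w"
      using not_le by blast
    then show ?thesis using True le h_w heur_goal[OF True] w(1) by (simp add: f_value_def)
  next
    case False
    have "w \<in> pverts (graph I)" using awalk_hd_in_verts[OF w(2)] by simp
    \<comment> \<open>The unscaled heuristic value of \<open>w\<close> is bounded by the cost of the
      remaining walk \<open>q\<close>, so the scaled one is strictly smaller than that cost.\<close>
    then have "\<alpha> * heur I w < heur I w" using heur_pos False assms(2) by simp
    then show ?thesis using v_le le h_w w(1) by (simp add: f_value_def)
  qed
  then show ?thesis by (simp add: f p(3))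
qed

text \<open>If \<open>v\<close> were not closed at the end, a frontier state would have evaluation
  below the optimal cost, whereas the minimal goal that stopped the search has at least that
  cost.\<close>

lemma less_opt_cost_expanded:
  assumes v: "v \<in> pverts (graph I) - goals I"
    and less: "dist_from_start I v + ereal (\<alpha> * heur I v) < opt_cost I"
  shows "v \<in> expanded \<alpha> r I"
proof -
  obtain n where fin: "finished \<alpha> I (state n)" using terminates by blast
  note inv = search_invar_state[of n]
  have "dist_from_start I v < \<infinity>" using less by auto
  then obtain p where p: "awalk (start I) p v" "dist_from_start I v = awalk_cost (cost I) p"
    using \<mu>_reach_conv dist_eq_walk unfolding dist_from_start_def by metis
  have "v \<in> dom (CLOSED (state n))"
  proof (rule ccontr)
    assume "v \<notin> dom (CLOSED (state n))"
    from frontier_f_value[OF inv this p(1)] obtain w where w: "w \<in> dom (OPEN (state n))"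
      "f_value \<alpha> I (state n) w \<le> awalk_cost (cost I) p + \<alpha> * heur I v" .
    \<comment> \<open>The frontier state shows that OPEN is not exhausted, so it was a minimal goal
      that ended the search.\<close>
    have "OPEN_min \<alpha> I (state n) \<noteq> {}"
      using OPEN_min_nonempty[OF finite_dom_OPEN[OF inv]] w(1) by blast
    then obtain t where t: "t \<in> OPEN_min \<alpha> I (state n)" "t \<in> goals I"
      using fin by (auto simp: finished_def)
    then obtain e where e: "OPEN (state n) t = Some e" by (auto simp: OPEN_min_def)
    obtain q where q: "awalk (start I) q t" "g_value e = awalk_cost (cost I) q"
      using OPEN_walk[OF inv e] .
    have "opt_cost I \<le> f_value \<alpha> I (state n) t"
      using opt_cost_le_walk[OF q(1) t(2)] heur_goal[OF t(2)] e q(2) by (simp add: f_value_def)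
    also have "\<dots> \<le> awalk_cost (cost I) p + \<alpha> * heur I v"
      using t(1) w by (force simp: OPEN_min_def)
    also have "\<dots> = dist_from_start I v + ereal (\<alpha> * heur I v)"
      by (simp add: p(2))
    finally show False using less by simp
  qed
  then show ?thesis using dom_CLOSED_subset_expanded by blast
qed

lemma expanded_eq:
  assumes "\<alpha> < 1"
  shows "expanded \<alpha> r I = {v \<in> pverts (graph I) - goals I.
    dist_from_start I v + ereal (\<alpha> * heur I v) < opt_cost I}"
proof -
  have "v \<in> pverts (graph I) - goals I" if "v \<in> expanded \<alpha> r I" for v
    using that by (rule expanded_cases)
  then show ?thesis
    using expanded_less_opt_cost[OF _ assms] less_opt_cost_expanded by blast
qed

end

section \<open>Inclusions between the sets of expanded states\<close>

context positive_consistent_search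
begin

lemma expanded_subset_S_le:
  assumes "legal_rule 1 r"
  shows "expanded 1 r I \<subseteq> S_le I"
proof
  interpret search_run I 1 r by unfold_locales (use assms in auto)
  fix v assume v: "v \<in> expanded 1 r I"
  then have "v \<in> pverts (graph I) - goals I" "reachable (with_proj (graph I)) (start I) v"
    by (auto elim: expanded_cases)
  then show "v \<in> S_le I" using expanded_le_opt_cost[OF v] by (simp add: S_le_def)
qed

lemma expanded_eq_sublevel:
  assumes "legal_rule \<alpha> r" "0 \<le> \<alpha>" "\<alpha> < 1"
  shows "expanded \<alpha> r I = {v \<in> pverts (graph I) - goals I.
    dist_from_start I v + ereal (\<alpha> * heur I v) < opt_cost I}"
proof -
  interpret search_run I \<alpha> r by unfold_locales (use assms in auto)
  show ?thesis using assms(3) by (rule expanded_eq)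
qed

text \<open>The sublevel set does not mention the rule, so it is the common value that the definite
  description asks for.\<close>

lemma E_set_eq_sublevel:
  assumes "0 \<le> \<alpha>" "\<alpha> < 1"
  shows "E_set \<alpha> I = {v \<in> pverts (graph I) - goals I.
    dist_from_start I v + ereal (\<alpha> * heur I v) < opt_cost I}"
  unfolding E_set_def
proof (rule the_equality)
  \<comment> \<open>Uniqueness needs an actual legal rule: without one, every \<open>S\<close> would
    qualify vacuously.\<close>
  obtain r :: "'v tie_rule" where r: "legal_rule \<alpha> r"
    using tie_breaker_exists[of \<alpha>, where 'r = unit] unfolding tie_breaker_def by blast
  fix S assume "\<forall>r. legal_rule \<alpha> r \<longrightarrow> expanded \<alpha> r I = S"
  then show "S = {v \<in> pverts (graph I) - goals I.
    dist_from_start I v + ereal (\<alpha> * heur I v) < opt_cost I}"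
    using r expanded_eq_sublevel[OF r assms] by blast
qed (use expanded_eq_sublevel assms in blast)

text \<open>As the heuristic is nonnegative, a smaller weight lowers the evaluation and enlarges the
  sublevel set.\<close>

lemma E_set_antimono:
  assumes "0 \<le> \<alpha>" "\<alpha> \<le> \<beta>" "\<beta> < 1"
  shows "E_set \<beta> I \<subseteq> E_set \<alpha> I"
proof
  fix v assume "v \<in> E_set \<beta> I"
  then have v: "v \<in> pverts (graph I) - goals I"
    "dist_from_start I v + ereal (\<beta> * heur I v) < opt_cost I"
    using assms by (auto simp: E_set_eq_sublevel)
  have "\<alpha> * heur I v \<le> \<beta> * heur I v"
    using v(1) heur_nonneg assms by (intro mult_right_mono) auto
  then have "dist_from_start I v + ereal (\<alpha> * heur I v)
      \<le> dist_from_start I v + ereal (\<beta> * heur I v)"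
    by (intro add_left_mono) simp
  then show "v \<in> E_set \<alpha> I" using v assms by (simp add: E_set_eq_sublevel)
qed

lemma S_le_subset_E_set:
  assumes "0 \<le> \<alpha>" "\<alpha> < 1"
  shows "S_le I \<subseteq> E_set \<alpha> I"
proof
  fix v assume "v \<in> S_le I"
  then have v: "v \<in> pverts (graph I) - goals I"
    "reachable (with_proj (graph I)) (start I) v"
    "dist_from_start I v + ereal (heur I v) \<le> opt_cost I"
    by (auto simp: S_le_def)
  \<comment> \<open>Reachability makes the distance a real number, so adding it preserves the strict
    inequality between the scaled and the full heuristic.\<close>
  obtain p where p: "dist_from_start I v = awalk_cost (cost I) p"
    using dist_eq_walk[OF v(2)] .
  have "\<alpha> * heur I v < heur I v" using v(1) heur_pos assms(2) by simp
  then have "dist_from_start I v + ereal (\<alpha> * heur I v) < dist_from_start I v + ereal (heur I v)"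
    by (simp add: p)
  also note v(3)
  finally show "v \<in> E_set \<alpha> I" using v(1) assms by (simp add: E_set_eq_sublevel)
qed

end

theorem corollary4:
  fixes I :: "'v search_instance"
  assumes "search_instance I"
    and "solvable I"
    and "consistent I"
    and "\<forall>v \<in> goals I. heur I v = 0"
    and "\<forall>v \<in> pverts (graph I) - goals I. 0 < heur I v"
  shows
    "(\<forall>\<alpha> (\<tau> :: 'r \<Rightarrow> 'v tie_rule) \<rho>. 0 \<le> \<alpha> \<and> \<alpha> < 1 \<and> tie_breaker \<alpha> \<tau> \<longrightarrow>
        expanded \<alpha> (\<tau> \<rho>) I = E_set \<alpha> I) \<and>
     (\<forall>(\<tau> :: 'r \<Rightarrow> 'v tie_rule) \<rho> \<alpha>. tie_breaker 1 \<tau> \<and> 0 \<le> \<alpha> \<and> \<alpha> < 1 \<longrightarrow>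
        expanded 1 (\<tau> \<rho>) I \<subseteq> S_le I \<and>
        S_le I \<subseteq> E_set \<alpha> I \<and>
        E_set \<alpha> I \<subseteq> E_set 0 I \<and>
        E_set 0 I = {v \<in> pverts (graph I) - goals I. dist_from_start I v < opt_cost I}) \<and>
     (\<forall>\<alpha> \<beta>. 0 \<le> \<alpha> \<and> \<alpha> < \<beta> \<and> \<beta> < 1 \<longrightarrow> E_set \<beta> I \<subseteq> E_set \<alpha> I)"
proof -
  interpret positive_consistent_search I
    using assms by unfold_locales auto
  have "expanded \<alpha> (\<tau> \<rho>) I = E_set \<alpha> I"
    if "0 \<le> \<alpha>" "\<alpha> < 1" "tie_breaker \<alpha> \<tau>" for \<alpha> and \<tau> :: "'r \<Rightarrow> 'v tie_rule" and \<rho>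
    using that expanded_eq_sublevel E_set_eq_sublevel by (simp add: tie_breaker_def)
  moreover have "expanded 1 (\<tau> \<rho>) I \<subseteq> S_le I"
    if "tie_breaker 1 \<tau>" for \<tau> :: "'r \<Rightarrow> 'v tie_rule" and \<rho>
    using that expanded_subset_S_le by (simp add: tie_breaker_def)
  moreover have "E_set 0 I = {v \<in> pverts (graph I) - goals I. dist_from_start I v < opt_cost I}"
    by (simp add: E_set_eq_sublevel zero_ereal_def[symmetric])
  moreover have "E_set \<alpha> I \<subseteq> E_set 0 I" if "0 \<le> \<alpha>" "\<alpha> < 1" for \<alpha>
    using that E_set_antimono[of 0 \<alpha>] by simp
  moreover have "E_set \<beta> I \<subseteq> E_set \<alpha> I" if "0 \<le> \<alpha>" "\<alpha> < \<beta>" "\<beta> < 1" for \<alpha> \<beta>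
    using that E_set_antimono[of \<alpha> \<beta>] by simp
  ultimately show ?thesis
    using S_le_subset_E_set by presburger
qed

end
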